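(* Let $\lambda\neq0$ be a real number. Every vector field $X=f_1e_1+f_2e_2+f_3e_3$ on $(H_3,g_1)$ with $$f_1=\tfrac{c_1}{2\lambda}x^2-\tfrac{\lambda c_1}{2}y^2+c_2x-\lambda c_3y+c_4,\qquad f_2=\tfrac{c_1}{\lambda}x+c_2,\qquad f_3=c_1y+c_3,$$ where $c_1,c_2,c_3,c_4\in\mathbb{R}$, is a Killing vector field of $(H_3,g_1)$. Moreover, a smooth vector field on $(H_3,g_1)$ is a Ricci collineation if and only if it is a curvature collineation.
   Context: The Heisenberg group $H_3$ is $\mathbb{R}^3$ with global coordinates $(x,y,z)$ and multiplication $(x,y,z)(\tilde x,\tilde y,\tilde z)=(x+\tilde x,y+\tilde y,z+\tilde z-x\tilde y)$. For $\lambda\neq0$, $g_1$ is the left-invariant Lorentzian metric $g_1=-\frac{1}{\lambda^2}dx^2+dy^2+(x\,dy+dz)^2$, with left-invariant orthonormal frame $e_1=\partial_z$, $e_2=\partial_y-x\partial_z$, $e_3=\lambda\partial_x$ ($e_3$ timelike). The curvature tensor is the $(1,3)$-tensor $R(X,Y)=[\nabla_X,\nabla_Y]-\nabla_{[X,Y]}$ of the Levi-Civita connection $\nabla$, and the Ricci tensor is $\varrho(X,Y)=\sum_k g(e_k,e_k)\,g(R(e_k,X)Y,e_k)$ for an orthonormal basis $\{e_k\}$. A smooth vector field $X$ is Killing if $\mathcal{L}_Xg=0$, a Ricci collineation if $\mathcal{L}_X\varrho=0$, and a curvature collineation if $\mathcal{L}_XR=0$. *)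

theory Defs
  imports "HOL-Analysis.Analysis"
begin

section \<open>Smooth maps and vector fields on \<open>\<real>\<^sup>n\<close>\<close>

text \<open>
  A vector field on \<open>\<real>\<^sup>n\<close> is a map \<open>X :: real ^ 'n \<Rightarrow> real ^ 'n\<close>; \<open>X p $ i\<close> is its component
  along the \<open>i\<close>-th coordinate field at \<open>p\<close>.
\<close>

type_synonym 'n vfield = "real ^ 'n \<Rightarrow> real ^ 'n"

primrec Ck :: "nat \<Rightarrow> ('a::real_normed_vector \<Rightarrow> 'b::real_normed_vector) \<Rightarrow> bool" where
  "Ck 0 f = continuous_on UNIV f"
| "Ck (Suc k) f = ((\<forall>p. f differentiable (at p)) \<and>
     (\<forall>v. Ck k (\<lambda>p. frechet_derivative f (at p) v)))"

text \<open>
  In finite dimension, asking for continuity of all iterated directional derivatives is the usual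
  notion of class \<open>C\<^sup>k\<close>.
\<close>

definition smooth :: "('a::real_normed_vector \<Rightarrow> 'b::real_normed_vector) \<Rightarrow> bool" where
  "smooth f \<longleftrightarrow> (\<forall>k. Ck k f)"

definition dderiv ::
  "'n::finite vfield \<Rightarrow> (real ^ 'n \<Rightarrow> 'b::real_normed_vector) \<Rightarrow> (real ^ 'n \<Rightarrow> 'b)" where
  "dderiv X f = (\<lambda>p. frechet_derivative f (at p) (X p))"

definition bracket :: "'n::finite vfield \<Rightarrow> 'n vfield \<Rightarrow> 'n vfield" where
  "bracket X Y = (\<lambda>p. dderiv X Y p - dderiv Y X p)"


section \<open>Levi-Civita connection and curvature of a metric on \<open>\<real>\<^sup>n\<close>\<close>

type_synonym 'n metric = "real ^ 'n \<Rightarrow> real ^ 'n \<Rightarrow> real ^ 'n \<Rightarrow> real"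

definition gram :: "'n::finite metric \<Rightarrow> real ^ 'n \<Rightarrow> real ^ 'n ^ 'n" where
  "gram g p = (\<chi> i j. g p (axis i 1) (axis j 1))"

definition dgram :: "'n::finite metric \<Rightarrow> real ^ 'n \<Rightarrow> 'n \<Rightarrow> 'n \<Rightarrow> 'n \<Rightarrow> real" where
  "dgram g p l i j = frechet_derivative (\<lambda>q. gram g q $ i $ j) (at p) (axis l 1)"

definition christoffel :: "'n::finite metric \<Rightarrow> real ^ 'n \<Rightarrow> 'n \<Rightarrow> 'n \<Rightarrow> 'n \<Rightarrow> real" where
  "christoffel g p k i j =
     (1/2) * (\<Sum>l\<in>UNIV. matrix_inv (gram g p) $ k $ l *
                (dgram g p i j l + dgram g p j i l - dgram g p l i j))"

text \<open>
  The Levi-Civita connection. The lemmas \<open>nabla_torsion_free\<close> and \<open>nabla_metric\<close> below show that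
  it is the torsion-free metric connection.
\<close>

definition nabla :: "'n::finite metric \<Rightarrow> 'n vfield \<Rightarrow> 'n vfield \<Rightarrow> 'n vfield" where
  "nabla g X Y = (\<lambda>p. dderiv X Y p +
     (\<chi> k. \<Sum>i\<in>UNIV. \<Sum>j\<in>UNIV. christoffel g p k i j * X p $ i * Y p $ j))"

definition curvature ::
  "'n::finite metric \<Rightarrow> 'n vfield \<Rightarrow> 'n vfield \<Rightarrow> 'n vfield \<Rightarrow> 'n vfield" where
  "curvature g X Y Z = (\<lambda>p.
     nabla g X (nabla g Y Z) p - nabla g Y (nabla g X Z) p - nabla g (bracket X Y) Z p)"

definition orthonormal_frame :: "'n::finite metric \<Rightarrow> ('n \<Rightarrow> 'n vfield) \<Rightarrow> bool" where
  "orthonormal_frame g e \<longleftrightarrow>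
     (\<forall>p i j. if i = j then \<bar>g p (e i p) (e j p)\<bar> = 1 else g p (e i p) (e j p) = 0)"

text \<open>The Ricci tensor, computed in an orthonormal frame \<open>e\<close>.\<close>

definition ricci ::
  "'n::finite metric \<Rightarrow> ('n \<Rightarrow> 'n vfield) \<Rightarrow> 'n vfield \<Rightarrow> 'n vfield \<Rightarrow> real ^ 'n \<Rightarrow> real" where
  "ricci g e X Y = (\<lambda>p. \<Sum>k\<in>UNIV. g p (e k p) (e k p) * g p (curvature g (e k) X Y p) (e k p))"


section \<open>Lie derivatives and collineations\<close>

text \<open>
  Tensor fields are given by their action on vector fields: a \<open>(0,2)\<close>-tensor field as a map
  \<open>T Y Z\<close> into functions, a \<open>(1,3)\<close>-tensor field as a map \<open>T Y Z W\<close> into vector fields.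
\<close>

definition lie02 ::
  "'n::finite vfield \<Rightarrow> ('n vfield \<Rightarrow> 'n vfield \<Rightarrow> real ^ 'n \<Rightarrow> real) \<Rightarrow>
   'n vfield \<Rightarrow> 'n vfield \<Rightarrow> real ^ 'n \<Rightarrow> real" where
  "lie02 X T Y Z = (\<lambda>p. dderiv X (T Y Z) p - T (bracket X Y) Z p - T Y (bracket X Z) p)"

definition lie13 ::
  "'n::finite vfield \<Rightarrow> ('n vfield \<Rightarrow> 'n vfield \<Rightarrow> 'n vfield \<Rightarrow> 'n vfield) \<Rightarrow>
   'n vfield \<Rightarrow> 'n vfield \<Rightarrow> 'n vfield \<Rightarrow> 'n vfield" where
  "lie13 X T Y Z W = (\<lambda>p. bracket X (T Y Z W) p
     - T (bracket X Y) Z W p - T Y (bracket X Z) W p - T Y Z (bracket X W) p)"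

definition killing :: "'n::finite metric \<Rightarrow> 'n vfield \<Rightarrow> bool" where
  "killing g X \<longleftrightarrow> smooth X \<and>
     (\<forall>Y Z. smooth Y \<longrightarrow> smooth Z \<longrightarrow>
        (\<forall>p. lie02 X (\<lambda>U V q. g q (U q) (V q)) Y Z p = 0))"

definition ricci_collineation ::
  "'n::finite metric \<Rightarrow> ('n \<Rightarrow> 'n vfield) \<Rightarrow> 'n vfield \<Rightarrow> bool" where
  "ricci_collineation g e X \<longleftrightarrow> smooth X \<and>
     (\<forall>Y Z. smooth Y \<longrightarrow> smooth Z \<longrightarrow> (\<forall>p. lie02 X (ricci g e) Y Z p = 0))"

definition curvature_collineation :: "'n::finite metric \<Rightarrow> 'n vfield \<Rightarrow> bool" where
  "curvature_collineation g X \<longleftrightarrow> smooth X \<and>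
     (\<forall>Y Z W. smooth Y \<longrightarrow> smooth Z \<longrightarrow> smooth W \<longrightarrow>
        (\<forall>p. lie13 X (curvature g) Y Z W p = 0))"


section \<open>The Heisenberg group with the metric \<open>g\<^sub>1\<close>\<close>

definition heis_mult :: "real ^ 3 \<Rightarrow> real ^ 3 \<Rightarrow> real ^ 3" where
  "heis_mult p q = vector [p$1 + q$1, p$2 + q$2, p$3 + q$3 - p$1 * q$2]"

definition heis_metric :: "real \<Rightarrow> 3 metric" where
  "heis_metric lam p v w =
     - (1 / lam\<^sup>2) * (v$1 * w$1) + v$2 * w$2 + (p$1 * v$2 + v$3) * (p$1 * w$2 + w$3)"

definition heis_frame :: "real \<Rightarrow> 3 \<Rightarrow> 3 vfield" where
  "heis_frame lam k p =
     (vector [vector [0, 0, 1], vector [0, 1, - (p$1)], vector [lam, 0, 0]] :: real ^ 3 ^ 3) $ k"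


section \<open>Consistency of the definitions\<close>

lemma heis_frame_orthonormal:
  assumes "lam \<noteq> 0"
  shows "orthonormal_frame (heis_metric lam) (heis_frame lam)"
    and "heis_metric lam p (heis_frame lam 3 p) (heis_frame lam 3 p) = -1"
    and "heis_metric lam p (heis_frame lam 2 p) (heis_frame lam 2 p) = 1"
    and "heis_metric lam p (heis_frame lam 1 p) (heis_frame lam 1 p) = 1"
  using assms
  by (auto simp: orthonormal_frame_def forall_3 heis_metric_def heis_frame_def power2_eq_square)

lemma heis_metric_left_invariant:
  assumes D: "(heis_mult a has_derivative D) (at p)"
  shows "heis_metric lam (heis_mult a p) (D v) (D w) = heis_metric lam p v w"
proof -
  have eq: "heis_mult a = (\<lambda>q. a + q - (a$1 * q$2) *\<^sub>R axis 3 1)"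
    by (rule ext) (simp add: heis_mult_def vec_eq_iff forall_3 axis_def)
  have "(heis_mult a has_derivative (\<lambda>v. v - (a$1 * v$2) *\<^sub>R axis 3 1)) (at p)"
    unfolding eq by (auto intro!: derivative_eq_intros bounded_linear.has_derivative[OF bounded_linear_vec_nth])
  then have "D = (\<lambda>v. v - (a$1 * v$2) *\<^sub>R axis 3 1)"
    using D has_derivative_unique by blast
  then show ?thesis
    by (simp add: heis_metric_def heis_mult_def axis_def algebra_simps)
qed

lemma dgram_sym:
  assumes "\<And>p v w. g p v w = g p w v"
  shows "dgram g p l i j = dgram g p l j i"
  using assms by (simp add: dgram_def gram_def)

lemma nabla_torsion_free:
  assumes sym: "\<And>p v w. g p v w = g p w v"
  shows "nabla g X Y p - nabla g Y X p = bracket X Y p"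
proof -
  have s: "dgram g p l i j = dgram g p l j i" for l i j
    by (rule dgram_sym) (rule sym)
  have c: "christoffel g p k i j = christoffel g p k j i" for k i j
    unfolding christoffel_def by (simp add: s[of _ i j] add.commute)
  have "(\<Sum>i\<in>UNIV. \<Sum>j\<in>UNIV. christoffel g p k i j * X p $ i * Y p $ j)
      = (\<Sum>i\<in>UNIV. \<Sum>j\<in>UNIV. christoffel g p k i j * Y p $ i * X p $ j)" for k
    by (subst sum.swap, subst c) (simp add: mult_ac)
  then show ?thesis
    by (simp add: nabla_def bracket_def vec_eq_iff)
qed

lemma christoffel_lowered:
  assumes inv: "invertible (gram g p)"
  shows "(\<Sum>k\<in>UNIV. gram g p $ m $ k * christoffel g p k i j)
      = (1/2) * (dgram g p i j m + dgram g p j i m - dgram g p m i j)"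
proof -
  let ?G = "gram g p" and ?N = "matrix_inv (gram g p)"
  let ?d = "\<lambda>l. dgram g p i j l + dgram g p j i l - dgram g p l i j"
  have id: "?G ** ?N = mat 1"
    using inv unfolding invertible_def matrix_inv_def by (metis (mono_tags, lifting) someI_ex)
  have "(\<Sum>k\<in>UNIV. ?G $ m $ k * christoffel g p k i j)
      = (\<Sum>k\<in>UNIV. \<Sum>l\<in>UNIV. (1/2) * (?G $ m $ k * ?N $ k $ l) * ?d l)"
    by (simp add: christoffel_def sum_distrib_left mult_ac)
  also have "\<dots> = (\<Sum>l\<in>UNIV. (1/2) * (?G ** ?N) $ m $ l * ?d l)"
    by (subst sum.swap) (simp add: matrix_matrix_mult_def sum_distrib_left sum_distrib_right)
  also have "\<dots> = (\<Sum>l\<in>UNIV. if l = m then (1/2) * ?d l else 0)"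
    unfolding id by (intro sum.cong) (auto simp: mat_def)
  also have "\<dots> = (1/2) * ?d m" by simp
  finally show ?thesis .
qed

lemma metric_gram:
  fixes g :: "'n::finite metric"
  assumes "bilinear (g p)"
  shows "g p v w = (\<Sum>i\<in>UNIV. \<Sum>j\<in>UNIV. v $ i * w $ j * gram g p $ i $ j)"
proof -
  have v: "(\<Sum>i\<in>UNIV. v $ i *\<^sub>R axis i 1) = v" for v :: "real ^ 'n"
    using basis_expansion[of v] by (simp add: scalar_mult_eq_scaleR)
  have "g p v w = g p (\<Sum>i\<in>UNIV. v $ i *\<^sub>R axis i 1) (\<Sum>j\<in>UNIV. w $ j *\<^sub>R axis j 1)"
    by (simp only: v)
  also have "\<dots> = (\<Sum>(i,j)\<in>UNIV \<times> UNIV. g p (v $ i *\<^sub>R axis i 1) (w $ j *\<^sub>R axis j 1))"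
    by (rule bilinear_sum[OF assms])
  also have "\<dots> = (\<Sum>i\<in>UNIV. \<Sum>j\<in>UNIV. g p (v $ i *\<^sub>R axis i 1) (w $ j *\<^sub>R axis j 1))"
    by (rule sum.cartesian_product[symmetric])
  also have "\<dots> = (\<Sum>i\<in>UNIV. \<Sum>j\<in>UNIV. v $ i * w $ j * gram g p $ i $ j)"
    by (simp only: bilinear_lmul[OF assms] bilinear_rmul[OF assms] gram_def vec_lambda_beta
        real_scaleR_def mult.assoc mult.left_commute)
  finally show ?thesis .
qed

lemma nabla_metric:
  fixes g :: "'n::finite metric"
  assumes sym: "\<And>p v w. g p v w = g p w v"
    and bil: "\<And>p. bilinear (g p)"
    and inv: "\<And>p. invertible (gram g p)"
    and dg: "\<And>p i j. (\<lambda>q. gram g q $ i $ j) differentiable (at p)"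
    and Y: "\<And>p. Y differentiable (at p)" and Z: "\<And>p. Z differentiable (at p)"
  shows "dderiv X (\<lambda>q. g q (Y q) (Z q)) p = g p (nabla g X Y p) (Z p) + g p (Y p) (nabla g X Z p)"
proof -
  let ?G = "\<lambda>i j. gram g p $ i $ j" and ?x = "X p" and ?y = "Y p" and ?z = "Z p"
  let ?Y' = "frechet_derivative Y (at p)" and ?Z' = "frechet_derivative Z (at p)"
  let ?G' = "\<lambda>i j. frechet_derivative (\<lambda>q. gram g q $ i $ j) (at p)"
  let ?C = "\<lambda>k i j. christoffel g p k i j"
  note bs = bilinear_ladd[OF bil] bilinear_radd[OF bil]
  have s: "dgram g p l i j = dgram g p l j i" for l i j
    by (rule dgram_sym) (rule sym)
  have DY: "(Y has_derivative ?Y') (at p)" and DZ: "(Z has_derivative ?Z') (at p)"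
    and DG: "\<And>i j. ((\<lambda>q. gram g q $ i $ j) has_derivative ?G' i j) (at p)"
    using Y Z dg by (simp_all add: frechet_derivative_works)
  have DYi: "((\<lambda>q. Y q $ i) has_derivative (\<lambda>h. ?Y' h $ i)) (at p)"
    and DZi: "((\<lambda>q. Z q $ i) has_derivative (\<lambda>h. ?Z' h $ i)) (at p)" for i
    using bounded_linear.has_derivative[OF bounded_linear_vec_nth DY]
      bounded_linear.has_derivative[OF bounded_linear_vec_nth DZ] by auto
  have "((\<lambda>q. g q (Y q) (Z q)) has_derivative
     (\<lambda>h. \<Sum>i\<in>UNIV. \<Sum>j\<in>UNIV. ?y $ i * ?z $ j * ?G' i j h
        + (?y $ i * ?Z' h $ j + ?Y' h $ i * ?z $ j) * ?G i j)) (at p)"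
    by (simp only: metric_gram[of g, OF bil],
        rule has_derivative_sum, rule has_derivative_sum,
        rule has_derivative_mult[OF has_derivative_mult[OF DYi DZi] DG])
  then have "dderiv X (\<lambda>q. g q (Y q) (Z q)) p
     = (\<Sum>i\<in>UNIV. \<Sum>j\<in>UNIV. ?y $ i * ?z $ j * ?G' i j ?x
        + (?y $ i * ?Z' ?x $ j + ?Y' ?x $ i * ?z $ j) * ?G i j)"
    unfolding dderiv_def by (rule fun_cong[OF frechet_derivative_at[symmetric]])
  also have "\<dots> = (\<Sum>i\<in>UNIV. \<Sum>j\<in>UNIV. ?y $ i * ?z $ j * ?G' i j ?x)
       + g p ?y (?Z' ?x) + g p (?Y' ?x) ?z"
    by (simp only: metric_gram[of g, OF bil] sum.distrib[symmetric] distrib_right add.assoc mult.assoc)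
  finally have 1: "dderiv X (\<lambda>q. g q (Y q) (Z q)) p = \<dots>" .
  have G'x: "?G' i j ?x = (\<Sum>l\<in>UNIV. ?x $ l * dgram g p l i j)" for i j
  proof -
    have lin: "linear (?G' i j)" using DG has_derivative_linear by blast
    have "?x = (\<Sum>l\<in>UNIV. ?x $ l *\<^sub>R axis l 1)"
      using basis_expansion[of ?x] by (simp add: scalar_mult_eq_scaleR)
    then have "?G' i j ?x = ?G' i j (\<Sum>l\<in>UNIV. ?x $ l *\<^sub>R axis l 1)" by (rule arg_cong)
    also have "\<dots> = (\<Sum>l\<in>UNIV. ?x $ l * dgram g p l i j)"
      by (simp add: linear_sum[OF lin] linear_scale[OF lin] dgram_def)
    finally show ?thesis .
  qed
  define \<Gamma> where "\<Gamma> y = (\<chi> k. \<Sum>i\<in>UNIV. \<Sum>j\<in>UNIV. ?C k i j * ?x $ i * y $ j)" for y :: "real ^ 'n"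
  have low: "g p z (\<Gamma> y) = (\<Sum>m\<in>UNIV. \<Sum>i\<in>UNIV. \<Sum>j\<in>UNIV. z $ m * ?x $ i * y $ j *
      ((1/2) * (dgram g p i j m + dgram g p j i m - dgram g p m i j)))" for y z
  proof -
    have "g p z (\<Gamma> y) = (\<Sum>m\<in>UNIV. \<Sum>k\<in>UNIV. \<Sum>i\<in>UNIV. \<Sum>j\<in>UNIV. z $ m * ?x $ i * y $ j * (?G m k * ?C k i j))"
      by (simp add: metric_gram[of g, OF bil] \<Gamma>_def sum_distrib_left sum_distrib_right mult_ac)
    also have "\<dots> = (\<Sum>m\<in>UNIV. \<Sum>i\<in>UNIV. \<Sum>k\<in>UNIV. \<Sum>j\<in>UNIV. z $ m * ?x $ i * y $ j * (?G m k * ?C k i j))"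
      by (rule sum.cong[OF refl], rule sum.swap)
    also have "\<dots> = (\<Sum>m\<in>UNIV. \<Sum>i\<in>UNIV. \<Sum>j\<in>UNIV. \<Sum>k\<in>UNIV. z $ m * ?x $ i * y $ j * (?G m k * ?C k i j))"
      by (rule sum.cong[OF refl], rule sum.cong[OF refl], rule sum.swap)
    also have "\<dots> = (\<Sum>m\<in>UNIV. \<Sum>i\<in>UNIV. \<Sum>j\<in>UNIV. z $ m * ?x $ i * y $ j *
      ((1/2) * (dgram g p i j m + dgram g p j i m - dgram g p m i j)))"
      by (simp only: sum_distrib_left[symmetric] christoffel_lowered[OF inv])
    finally show ?thesis .
  qed
  have rev: "(\<Sum>m\<in>UNIV. \<Sum>i\<in>UNIV. \<Sum>j\<in>UNIV. F m i j) = (\<Sum>m\<in>UNIV. \<Sum>i\<in>UNIV. \<Sum>j\<in>UNIV. F j i m)"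
    for F :: "'n \<Rightarrow> 'n \<Rightarrow> 'n \<Rightarrow> real"
  proof -
    have "(\<Sum>m\<in>UNIV. \<Sum>i\<in>UNIV. \<Sum>j\<in>UNIV. F m i j) = (\<Sum>i\<in>UNIV. \<Sum>m\<in>UNIV. \<Sum>j\<in>UNIV. F m i j)"
      by (rule sum.swap)
    also have "\<dots> = (\<Sum>i\<in>UNIV. \<Sum>j\<in>UNIV. \<Sum>m\<in>UNIV. F m i j)"
      by (rule sum.cong[OF refl], rule sum.swap)
    also have "\<dots> = (\<Sum>j\<in>UNIV. \<Sum>i\<in>UNIV. \<Sum>m\<in>UNIV. F m i j)"
      by (rule sum.swap)
    finally show ?thesis .
  qed
  have "g p ?z (\<Gamma> ?y) + g p ?y (\<Gamma> ?z) = (\<Sum>m\<in>UNIV. \<Sum>i\<in>UNIV. \<Sum>j\<in>UNIV. ?y $ m * ?x $ i * ?z $ j * dgram g p i m j)"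
    unfolding low[of ?z ?y] low[of ?y ?z]
    apply (subst rev)
    apply (simp only: sum.distrib[symmetric])
    apply (rule sum.cong[OF refl], rule sum.cong[OF refl], rule sum.cong[OF refl])
    subgoal for m i j
      by (simp add: s[of i j m] s[of j i m] s[of m i j] algebra_simps)
    done
  also have "\<dots> = (\<Sum>i\<in>UNIV. \<Sum>j\<in>UNIV. ?y $ i * ?z $ j * ?G' i j ?x)"
    unfolding G'x sum_distrib_left
    by (rule sum.cong[OF refl], subst sum.swap) (simp add: mult_ac)
  finally have 2: "g p ?z (\<Gamma> ?y) + g p ?y (\<Gamma> ?z) = \<dots>" .
  have "nabla g X Y p = ?Y' ?x + \<Gamma> ?y" "nabla g X Z p = ?Z' ?x + \<Gamma> ?z"
    by (simp_all add: nabla_def dderiv_def \<Gamma>_def)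
  with 1 2 show ?thesis using sym by (simp add: bs)
qed

lemma heis_metric_sym: "heis_metric lam p v w = heis_metric lam p w v"
  by (simp add: heis_metric_def mult.commute)

lemma bilinear_heis_metric: "bilinear (heis_metric lam p)"
  unfolding bilinear_def heis_metric_def
  by (intro conjI allI linearI) (simp_all add: algebra_simps)

lemma invertible_gram_heis_metric:
  assumes "lam \<noteq> 0"
  shows "invertible (gram (heis_metric lam) p)"
  using assms
  by (simp add: invertible_det_nz det_3 gram_def heis_metric_def axis_def algebra_simps)

lemma gram_heis_metric_differentiable:
  "(\<lambda>q. gram (heis_metric lam) q $ i $ j) differentiable (at p)"
proof -
  have "(\<lambda>q :: real ^ 3. q $ 1) differentiable (at p)"
    by (rule bounded_linear_imp_differentiable) (rule bounded_linear_vec_nth)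
  then show ?thesis
    unfolding gram_def heis_metric_def vec_lambda_beta
    by (intro differentiable_add differentiable_mult differentiable_const)
qed

lemma nabla_heis_metric:
  assumes "lam \<noteq> 0"
    and "\<And>p. Y differentiable (at p)" and "\<And>p. Z differentiable (at p)"
  shows "dderiv X (\<lambda>q. heis_metric lam q (Y q) (Z q)) p =
      heis_metric lam p (nabla (heis_metric lam) X Y p) (Z p) +
      heis_metric lam p (Y p) (nabla (heis_metric lam) X Z p)"
    and "nabla (heis_metric lam) X Y p - nabla (heis_metric lam) Y X p = bracket X Y p"
  using assms
  by (auto intro!: nabla_metric nabla_torsion_free heis_metric_sym bilinear_heis_metric
      invertible_gram_heis_metric gram_heis_metric_differentiable)

end

(* In the left-invariant frame e1, e2, e3, with [e2, e3] = lam e1 as the only nonzero bracket, the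
   Lie derivative along X of a left-invariant tensor is the algebraic action of a matrix M (of
   Y |-> - [X, Y]) on it.  The Ricci tensor is lam^2/2 diag(-1, 1, -1).  It is a trace of the
   curvature, so M preserves it if M preserves the curvature.  Conversely, the Ricci equations are
   a first-order system for the components of X; commuting derivatives shows that e1 annihilates
   the second and third component, which leaves for M only an infinitesimal boost in the plane of
   e2 and e3, and such a boost preserves the curvature. *)

theory Submission
  imports Defs
begin

section \<open>Smooth functions\<close>

lemma Ck_Suc_D: "Ck (Suc k) f \<Longrightarrow> Ck k f"
proof (induction k arbitrary: f)
  case 0
  then show ?case
    by (auto simp: continuous_on_eq_continuous_at differentiable_imp_continuous_within)
next
  case (Suc k)
  then show ?case by (simp del: Ck.simps(1))
qed

lemma frechet_derivative_eqI:
  "(f has_derivative f') (at p) \<Longrightarrow> frechet_derivative f (at p) v = f' v"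
  by (simp add: frechet_derivative_at[symmetric])

lemma Ck_const: "Ck k (\<lambda>p. c)"
  by (induction k arbitrary: c) auto

lemma Ck_add: "Ck k f \<Longrightarrow> Ck k g \<Longrightarrow> Ck k (\<lambda>p. f p + g p)"
proof (induction k arbitrary: f g)
  case 0
  then show ?case by (auto intro: continuous_on_add)
next
  case (Suc k)
  then have "frechet_derivative (\<lambda>p. f p + g p) (at p) v =
      frechet_derivative f (at p) v + frechet_derivative g (at p) v" for p v
    by (intro frechet_derivative_eqI has_derivative_add) (auto simp: frechet_derivative_works)
  with Suc show ?case by auto
qed

lemma Ck_mult:
  fixes f g :: "'a::real_normed_vector \<Rightarrow> 'b::real_normed_algebra"
  shows "Ck k f \<Longrightarrow> Ck k g \<Longrightarrow> Ck k (\<lambda>p. f p * g p)"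
proof (induction k arbitrary: f g)
  case 0
  then show ?case by (auto intro: continuous_on_mult)
next
  case (Suc k)
  then have "frechet_derivative (\<lambda>p. f p * g p) (at p) v =
      f p * frechet_derivative g (at p) v + frechet_derivative f (at p) v * g p" for p v
    by (intro frechet_derivative_eqI has_derivative_mult) (auto simp: frechet_derivative_works)
  \<comment> \<open>The product rule pairs each derivative with an undifferentiated factor, so
    \<open>f\<close> and \<open>g\<close> themselves are also needed at level
    \<open>k\<close>.\<close>
  with Suc Ck_Suc_D[OF Suc(2)] Ck_Suc_D[OF Suc(3)] show ?case by (auto intro!: Ck_add)
qed

lemma Ck_bounded_linear_compose:
  assumes "bounded_linear L"
  shows "Ck k f \<Longrightarrow> Ck k (\<lambda>p. L (f p))"
proof (induction k arbitrary: f)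
  case 0
  then show ?case using bounded_linear.continuous_on[OF assms] by auto
next
  case (Suc k)
  then have d: "((\<lambda>p. L (f p)) has_derivative (\<lambda>v. L (frechet_derivative f (at p) v))) (at p)" for p
    by (intro bounded_linear.has_derivative[OF assms]) (auto simp: frechet_derivative_works)
  with Suc show ?case by (auto simp: frechet_derivative_eqI[OF d] differentiable_def)
qed

lemma smooth_const: "smooth (\<lambda>p. c)"
  by (simp add: smooth_def Ck_const)

lemma smooth_add: "smooth f \<Longrightarrow> smooth g \<Longrightarrow> smooth (\<lambda>p. f p + g p)"
  by (simp add: smooth_def Ck_add)

lemma smooth_mult:
  fixes f g :: "'a::real_normed_vector \<Rightarrow> 'b::real_normed_algebra"
  shows "smooth f \<Longrightarrow> smooth g \<Longrightarrow> smooth (\<lambda>p. f p * g p)"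
  by (simp add: smooth_def Ck_mult)

lemma smooth_bounded_linear_compose:
  "bounded_linear L \<Longrightarrow> smooth f \<Longrightarrow> smooth (\<lambda>p. L (f p))"
  by (simp add: smooth_def Ck_bounded_linear_compose)

lemma smooth_diff:
  assumes "smooth f" "smooth g"
  shows "smooth (\<lambda>p. f p - g p)"
  using smooth_add[OF assms(1)
      smooth_bounded_linear_compose[OF bounded_linear_minus[OF bounded_linear_ident] assms(2)]]
  by simp

lemma smooth_divide:
  fixes f :: "'a::real_normed_vector \<Rightarrow> real"
  shows "smooth f \<Longrightarrow> smooth (\<lambda>p. f p / c)"
  by (rule smooth_bounded_linear_compose[OF bounded_linear_divide])

lemma smooth_power:
  fixes f :: "'a::real_normed_vector \<Rightarrow> real"
  shows "smooth f \<Longrightarrow> smooth (\<lambda>p. f p ^ n)"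
  by (induction n) (auto intro: smooth_const smooth_mult)

lemma smooth_sum: "(\<And>i. i \<in> I \<Longrightarrow> smooth (f i)) \<Longrightarrow> smooth (\<lambda>p. \<Sum>i\<in>I. f i p)"
  by (induction I rule: infinite_finite_induct) (auto intro: smooth_const smooth_add)

lemma smooth_differentiable: "smooth f \<Longrightarrow> f differentiable (at p)"
  by (auto simp: smooth_def dest: spec[of _ "Suc 0"])

lemma smooth_has_derivative: "smooth f \<Longrightarrow> (f has_derivative frechet_derivative f (at p)) (at p)"
  using smooth_differentiable frechet_derivative_works by blast

lemma smooth_frechet_derivative: "smooth f \<Longrightarrow> smooth (\<lambda>p. frechet_derivative f (at p) v)"
  unfolding smooth_def by (metis Ck.simps(2))

lemma smooth_continuous: "smooth f \<Longrightarrow> isCont f p"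
  using smooth_differentiable differentiable_imp_continuous_within by blast

text \<open>The derivative of \<open>L\<close> is \<open>L\<close> at every point, so each
  directional derivative is already constant.\<close>

lemma smooth_bounded_linear:
  assumes "bounded_linear L"
  shows "smooth L"
  unfolding smooth_def
proof
  fix k
  have d: "(L has_derivative L) (at p)" for p
    by (rule bounded_linear_imp_has_derivative[OF assms])
  show "Ck k L"
  proof (cases k)
    case 0
    then show ?thesis using bounded_linear.continuous_on[OF assms continuous_on_id] by simp
  next
    case (Suc m)
    then show ?thesis
      using d by (auto simp: frechet_derivative_eqI[OF d] Ck_const differentiable_def)
  qed
qed

lemma smooth_coord: "smooth (\<lambda>p :: real ^ 'n. p $ i)"
  by (rule smooth_bounded_linear[OF bounded_linear_vec_nth])

lemma smooth_vec_nth: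
  fixes f :: "'a::real_normed_vector \<Rightarrow> real ^ 'n"
  shows "smooth f \<Longrightarrow> smooth (\<lambda>p. f p $ i)"
  by (rule smooth_bounded_linear_compose[OF bounded_linear_vec_nth])

lemma smooth_vecI:
  fixes f :: "'a::real_normed_vector \<Rightarrow> real ^ 'n"
  assumes "\<And>i. smooth (\<lambda>p. f p $ i)"
  shows "smooth f"
proof -
  have eq: "f = (\<lambda>p. \<Sum>i\<in>UNIV. f p $ i *\<^sub>R axis i 1)"
    using basis_expansion[of "f _"] by (auto simp: scalar_mult_eq_scaleR)
  show ?thesis
    by (subst eq, rule smooth_sum)
      (rule smooth_bounded_linear_compose[OF bounded_linear_scaleR_left assms])
qed

lemmas smooth_intros = smooth_const smooth_add smooth_diff smooth_mult smooth_divide smooth_power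
  smooth_coord smooth_vec_nth

section \<open>Symmetry of second directional derivatives\<close>

lemma second_difference_mvt:
  fixes f :: "'a::real_normed_vector \<Rightarrow> real"
  assumes f: "smooth f" and h: "0 < h"
  shows "\<exists>s t. 0 < s \<and> s < h \<and> 0 < t \<and> t < h \<and>
    f (p + h *\<^sub>R v + h *\<^sub>R w) - f (p + h *\<^sub>R v) - f (p + h *\<^sub>R w) + f p =
    h\<^sup>2 * frechet_derivative (\<lambda>q. frechet_derivative f (at q) v) (at (p + s *\<^sub>R v + t *\<^sub>R w)) w"
proof -
  let ?Dv = "\<lambda>q. frechet_derivative f (at q) v"
  have line: "((\<lambda>s. g (c + s *\<^sub>R u)) has_real_derivative frechet_derivative g (at (c + s *\<^sub>R u)) u) (at s)"
    if g: "smooth g" for g :: "'a \<Rightarrow> real" and c u s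
  proof -
    have lin: "linear (frechet_derivative g (at q))" for q
      using smooth_has_derivative[OF g] has_derivative_linear by blast
    have "((\<lambda>s. c + s *\<^sub>R u) has_derivative (\<lambda>s. s *\<^sub>R u)) (at s)"
      by (auto intro!: derivative_eq_intros)
    from has_derivative_compose[OF this smooth_has_derivative[OF g]]
    show ?thesis
      unfolding has_field_derivative_def
      by (simp add: linear_scale[OF lin] mult.commute[of _ "frechet_derivative g _ u"])
  qed
  \<comment> \<open>The second difference is the increment over \<open>[0, h]\<close> of this
    function of \<open>s\<close>. The mean value theorem in direction \<open>v\<close> turns it into
    a difference of first derivatives, and a second use in direction \<open>w\<close> gives the
    second derivative.\<close>
  have "((\<lambda>s. f (p + h *\<^sub>R w + s *\<^sub>R v) - f (p + s *\<^sub>R v)) has_real_derivative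
      ?Dv (p + h *\<^sub>R w + s *\<^sub>R v) - ?Dv (p + s *\<^sub>R v)) (at s)" for s
    by (intro DERIV_diff line f)
  from MVT2[OF h this]
  obtain s where s: "0 < s" "s < h" and
    1: "f (p + h *\<^sub>R w + h *\<^sub>R v) - f (p + h *\<^sub>R v) - (f (p + h *\<^sub>R w) - f p) =
      h * (?Dv (p + h *\<^sub>R w + s *\<^sub>R v) - ?Dv (p + s *\<^sub>R v))"
    by auto
  have "((\<lambda>t. ?Dv (p + s *\<^sub>R v + t *\<^sub>R w)) has_real_derivative
      frechet_derivative ?Dv (at (p + s *\<^sub>R v + t *\<^sub>R w)) w) (at t)" for t
    by (intro line smooth_frechet_derivative f)
  from MVT2[OF h this]
  obtain t where t: "0 < t" "t < h" and
    2: "?Dv (p + s *\<^sub>R v + h *\<^sub>R w) - ?Dv (p + s *\<^sub>R v) =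
      h * frechet_derivative ?Dv (at (p + s *\<^sub>R v + t *\<^sub>R w)) w"
    by auto
  from 1 2 s t show ?thesis
    by (intro exI[of _ s] exI[of _ t]) (simp add: add_ac power2_eq_square)
qed

text \<open>The second difference is symmetric in \<open>v\<close> and \<open>w\<close>. Divided by
  the square of the step it is a value of either mixed derivative near \<open>p\<close>; both are
  continuous, so shrinking the step identifies them at \<open>p\<close>.\<close>

lemma frechet_derivative_commute:
  fixes f :: "'a::real_normed_vector \<Rightarrow> real"
  assumes f: "smooth f"
  shows "frechet_derivative (\<lambda>q. frechet_derivative f (at q) v) (at p) w =
    frechet_derivative (\<lambda>q. frechet_derivative f (at q) w) (at p) v"
proof -
  let ?D = "\<lambda>v w q. frechet_derivative (\<lambda>q. frechet_derivative f (at q) v) (at q) w"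
  \<comment> \<open>A positive null sequence of step sizes; the intermediate points are squeezed
    between 0 and \<open>h n\<close>.\<close>
  define h where "h n = inverse (real (Suc n))" for n
  have h: "0 < h n" for n by (simp add: h_def)
  have h0: "h \<longlonglongrightarrow> 0"
    unfolding h_def using LIMSEQ_inverse_real_of_nat by simp
  have lim: "(\<lambda>n. ?D v w (p + s n *\<^sub>R v + t n *\<^sub>R w)) \<longlonglongrightarrow> ?D v w p"
    if "\<And>n. 0 < s n \<and> s n < h n \<and> 0 < t n \<and> t n < h n" for s t v w
  proof -
    have "s \<longlonglongrightarrow> 0" "t \<longlonglongrightarrow> 0"
      using that by (auto intro!: tendsto_sandwich[OF _ _ tendsto_const h0] always_eventually less_imp_le)
    then have "(\<lambda>n. p + s n *\<^sub>R v + t n *\<^sub>R w) \<longlonglongrightarrow> p + 0 *\<^sub>R v + 0 *\<^sub>R w"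
      by (intro tendsto_intros)
    then have "(\<lambda>n. p + s n *\<^sub>R v + t n *\<^sub>R w) \<longlonglongrightarrow> p" by simp
    with smooth_continuous[OF smooth_frechet_derivative[OF smooth_frechet_derivative[OF f]]]
    show ?thesis by (rule isCont_tendsto_compose)
  qed
  obtain s t where 1: "\<And>n. 0 < s n \<and> s n < h n \<and> 0 < t n \<and> t n < h n"
    "\<And>n. f (p + h n *\<^sub>R v + h n *\<^sub>R w) - f (p + h n *\<^sub>R v) - f (p + h n *\<^sub>R w) + f p =
      (h n)\<^sup>2 * ?D v w (p + s n *\<^sub>R v + t n *\<^sub>R w)"
    using second_difference_mvt[OF f h, where p = p and v = v and w = w] by metis
  obtain s' t' where 2: "\<And>n. 0 < s' n \<and> s' n < h n \<and> 0 < t' n \<and> t' n < h n"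
    "\<And>n. f (p + h n *\<^sub>R w + h n *\<^sub>R v) - f (p + h n *\<^sub>R w) - f (p + h n *\<^sub>R v) + f p =
      (h n)\<^sup>2 * ?D w v (p + s' n *\<^sub>R w + t' n *\<^sub>R v)"
    using second_difference_mvt[OF f h, where p = p and v = w and w = v] by metis
  have eq: "(h n)\<^sup>2 * ?D v w (p + s n *\<^sub>R v + t n *\<^sub>R w) =
      (h n)\<^sup>2 * ?D w v (p + s' n *\<^sub>R w + t' n *\<^sub>R v)" for n
  proof -
    have c: "p + h n *\<^sub>R v + h n *\<^sub>R w = p + h n *\<^sub>R w + h n *\<^sub>R v" by (simp add: add_ac)
    show ?thesis using 1(2)[of n] 2(2)[of n] unfolding c by linarith
  qed
  have "?D v w (p + s n *\<^sub>R v + t n *\<^sub>R w) = ?D w v (p + s' n *\<^sub>R w + t' n *\<^sub>R v)" for n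
    using eq[of n] h[of n] by simp
  with lim[where v = v and w = w, OF 1(1)] lim[where v = w and w = v, OF 2(1)] show ?thesis
    using LIMSEQ_unique by simp
qed


section \<open>Vector fields as derivations\<close>

lemma dderiv_sum:
  assumes f: "smooth f" and Y: "Y p = (\<Sum>j\<in>J. a j *\<^sub>R e j p)"
  shows "dderiv Y f p = (\<Sum>j\<in>J. a j *\<^sub>R dderiv (e j) f p)"
proof -
  have "linear (frechet_derivative f (at p))"
    using smooth_has_derivative[OF f] has_derivative_linear by blast
  then show ?thesis
    by (simp add: dderiv_def Y linear_sum linear_scale)
qed

lemma dderiv_sum_coord:
  fixes X :: "'n::finite vfield"
  assumes "smooth f"
  shows "dderiv X f p = (\<Sum>i\<in>UNIV. X p $ i *\<^sub>R frechet_derivative f (at p) (axis i 1))"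
proof -
  have "X p = (\<Sum>i\<in>UNIV. X p $ i *\<^sub>R axis i 1)"
    using basis_expansion[of "X p"] by (simp add: scalar_mult_eq_scaleR)
  from dderiv_sum[of f X p "\<lambda>i. X p $ i" "\<lambda>i p. axis i 1", OF assms this]
  show ?thesis by (simp add: dderiv_def)
qed

lemma dderiv_vec_nth:
  fixes Y :: "real ^ 'n::finite \<Rightarrow> real ^ 'm"
  assumes "smooth Y"
  shows "dderiv X Y p $ i = dderiv X (\<lambda>q. Y q $ i) p"
  unfolding dderiv_def
  by (rule frechet_derivative_eqI[symmetric])
    (rule bounded_linear.has_derivative[OF bounded_linear_vec_nth smooth_has_derivative[OF assms]])

lemma smooth_dderiv:
  fixes f :: "real ^ 'n::finite \<Rightarrow> real"
  assumes "smooth X" "smooth f"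
  shows "smooth (dderiv X f)"
proof -
  have "dderiv X f = (\<lambda>p. \<Sum>i\<in>UNIV. X p $ i * frechet_derivative f (at p) (axis i 1))"
    using dderiv_sum_coord[OF assms(2)] by auto
  then show ?thesis
    using assms by (auto intro!: smooth_sum smooth_mult smooth_vec_nth smooth_frechet_derivative)
qed

lemma dderiv_const: "dderiv X (\<lambda>p. c) = (\<lambda>p. 0)"
  by (simp add: dderiv_def)

lemma dderiv_coord: "dderiv X (\<lambda>q. q $ i) p = X p $ i"
  unfolding dderiv_def
  by (rule frechet_derivative_eqI) (rule bounded_linear_imp_has_derivative[OF bounded_linear_vec_nth])

lemma dderiv_add:
  assumes "smooth f" "smooth g"
  shows "dderiv X (\<lambda>q. f q + g q) p = dderiv X f p + dderiv X g p"
  unfolding dderiv_def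
  by (rule frechet_derivative_eqI)
    (intro has_derivative_add smooth_has_derivative[OF assms(1)] smooth_has_derivative[OF assms(2)])

lemma dderiv_diff:
  assumes "smooth f" "smooth g"
  shows "dderiv X (\<lambda>q. f q - g q) p = dderiv X f p - dderiv X g p"
  unfolding dderiv_def
  by (rule frechet_derivative_eqI)
    (intro has_derivative_diff smooth_has_derivative[OF assms(1)] smooth_has_derivative[OF assms(2)])

lemma dderiv_mult:
  fixes f g :: "real ^ 'n::finite \<Rightarrow> real"
  assumes "smooth f" "smooth g"
  shows "dderiv X (\<lambda>q. f q * g q) p = dderiv X f p * g p + f p * dderiv X g p"
  unfolding dderiv_def
  by (subst frechet_derivative_eqI[OF has_derivative_mult[OF smooth_has_derivative[OF assms(1)]
        smooth_has_derivative[OF assms(2)]]]) simp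

lemma dderiv_divide:
  fixes f :: "real ^ 'n::finite \<Rightarrow> real"
  assumes "smooth f"
  shows "dderiv X (\<lambda>q. f q / c) p = dderiv X f p / c"
  unfolding dderiv_def
  by (rule frechet_derivative_eqI)
    (rule bounded_linear.has_derivative[OF bounded_linear_divide smooth_has_derivative[OF assms]])

lemma dderiv_power2:
  fixes f :: "real ^ 'n::finite \<Rightarrow> real"
  assumes "smooth f"
  shows "dderiv X (\<lambda>q. (f q)\<^sup>2) p = 2 * f p * dderiv X f p"
  by (simp add: power2_eq_square dderiv_mult assms)

lemmas dderiv_simps = dderiv_const dderiv_coord dderiv_add dderiv_diff dderiv_mult dderiv_divide
  dderiv_power2

lemma bracket_nth:
  assumes "smooth Y" "smooth Z"
  shows "bracket Y Z p $ i = dderiv Y (\<lambda>q. Z q $ i) p - dderiv Z (\<lambda>q. Y q $ i) p"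
  using assms by (simp add: bracket_def dderiv_vec_nth)

lemma smooth_bracket:
  assumes "smooth Y" "smooth Z"
  shows "smooth (bracket Y Z)"
proof (rule smooth_vecI)
  fix i
  show "smooth (\<lambda>p. bracket Y Z p $ i)"
    unfolding bracket_nth[OF assms] by (intro smooth_diff smooth_dderiv smooth_vec_nth assms)
qed

text \<open>In the commutator the second derivatives of \<open>f\<close> cancel because the Hessian
  is symmetric. What is left differentiates only the components of \<open>Y\<close> and
  \<open>Z\<close>, and these terms form the bracket.\<close>

lemma dderiv_bracket:
  fixes f :: "real ^ 'n::finite \<Rightarrow> real"
  assumes Y: "smooth Y" and Z: "smooth Z" and f: "smooth f"
  shows "dderiv (bracket Y Z) f p = dderiv Y (dderiv Z f) p - dderiv Z (dderiv Y f) p"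
proof -
  let ?D = "\<lambda>i p. frechet_derivative f (at p) (axis i 1)"
  let ?H = "\<lambda>i j. frechet_derivative (?D i) (at p) (axis j 1)"
  note sD = smooth_frechet_derivative[OF f]
  \<comment> \<open>Product rule applied to the coordinate expansion of \<open>dderiv Z f\<close>: a
    first-order part plus the Hessian evaluated on \<open>Z\<close> and \<open>Y\<close>.\<close>
  have *: "dderiv Y (dderiv Z f) p = (\<Sum>i\<in>UNIV. dderiv Y (\<lambda>q. Z q $ i) p * ?D i p) +
      (\<Sum>i\<in>UNIV. \<Sum>j\<in>UNIV. Z p $ i * Y p $ j * ?H i j)"
    if Y: "smooth Y" and Z: "smooth Z" for Y Z
  proof -
    have "dderiv Z f = (\<lambda>q. \<Sum>i\<in>UNIV. Z q $ i * ?D i q)"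
      using dderiv_sum_coord[OF f] by auto
    moreover have "((\<lambda>q. \<Sum>i\<in>UNIV. Z q $ i * ?D i q) has_derivative
        (\<lambda>v. \<Sum>i\<in>UNIV. frechet_derivative (\<lambda>q. Z q $ i * ?D i q) (at p) v)) (at p)"
      by (intro has_derivative_sum smooth_has_derivative smooth_mult smooth_vec_nth Z sD)
    ultimately have "dderiv Y (dderiv Z f) p = (\<Sum>i\<in>UNIV. dderiv Y (\<lambda>q. Z q $ i * ?D i q) p)"
      by (simp add: dderiv_def frechet_derivative_eqI)
    also have "\<dots> = (\<Sum>i\<in>UNIV. dderiv Y (\<lambda>q. Z q $ i) p * ?D i p + Z p $ i * dderiv Y (?D i) p)"
      by (simp add: dderiv_mult smooth_vec_nth Z sD)
    finally show ?thesis
      by (simp add: dderiv_sum_coord[OF sD] sum.distrib sum_distrib_left mult.assoc)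
  qed
  have "?H i j = ?H j i" for i j
    by (rule frechet_derivative_commute[OF f])
  then have "(\<Sum>i\<in>UNIV. \<Sum>j\<in>UNIV. Z p $ i * Y p $ j * ?H i j) =
      (\<Sum>i\<in>UNIV. \<Sum>j\<in>UNIV. Y p $ i * Z p $ j * ?H i j)"
    by (subst sum.swap) (simp add: mult_ac)
  then show ?thesis
    by (simp add: *[OF Y Z] *[OF Z Y] dderiv_sum_coord[OF f] bracket_nth[OF Y Z]
        left_diff_distrib sum_subtractf)
qed


section \<open>The Heisenberg group in its left-invariant frame\<close>

text \<open>The coefficients of \<open>Y\<close> in the frame \<open>e1, e2, e3\<close>. The term
  \<open>p$1 * Y p $ 2\<close> compensates the z-component of \<open>e2\<close>.\<close>

definition frame_comp :: "real \<Rightarrow> 3 vfield \<Rightarrow> 3 vfield" where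
  "frame_comp lam Y p = vector [p$1 * Y p $ 2 + Y p $ 3, Y p $ 2, Y p $ 1 / lam]"

text \<open>For constant \<open>a\<close> this is a left-invariant field. Such fields serve as test
  fields whose frame components are prescribed at all points at once.\<close>

definition frame_field :: "real \<Rightarrow> real ^ 3 \<Rightarrow> 3 vfield" where
  "frame_field lam a p = (\<Sum>j\<in>UNIV. a $ j *\<^sub>R heis_frame lam j p)"

lemma frame_comp_nth:
  "frame_comp lam Y p $ 1 = p$1 * Y p $ 2 + Y p $ 3"
  "frame_comp lam Y p $ 2 = Y p $ 2"
  "frame_comp lam Y p $ 3 = Y p $ 1 / lam"
  by (simp_all add: frame_comp_def)

lemma heis_frame_nth:
  "heis_frame lam 1 p = vector [0, 0, 1]"
  "heis_frame lam 2 p = vector [0, 1, - p$1]"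
  "heis_frame lam 3 p = vector [lam, 0, 0]"
  by (simp_all add: heis_frame_def)

lemma smooth_frame_comp: "smooth Y \<Longrightarrow> smooth (frame_comp lam Y)"
proof (rule smooth_vecI)
  fix i :: 3 assume "smooth Y"
  then show "smooth (\<lambda>p. frame_comp lam Y p $ i)"
    using exhaust_3[of i] by (elim disjE) (simp_all add: frame_comp_nth smooth_intros)
qed

lemma frame_field_nth:
  "frame_field lam a p $ 1 = lam * a$3"
  "frame_field lam a p $ 2 = a$2"
  "frame_field lam a p $ 3 = a$1 - p$1 * a$2"
  by (simp_all add: frame_field_def sum_3 heis_frame_nth)

lemma smooth_frame_field: "smooth a \<Longrightarrow> smooth (\<lambda>p. frame_field lam (a p) p)"
proof (rule smooth_vecI)
  fix i :: 3 assume "smooth a"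
  then show "smooth (\<lambda>p. frame_field lam (a p) p $ i)"
    using exhaust_3[of i] by (elim disjE) (simp_all add: frame_field_nth smooth_intros)
qed

lemma heis_frame_eq_frame_field: "heis_frame lam k = frame_field lam (axis k 1)"
  by (rule ext) (simp add: frame_field_def axis_def if_distrib[of "\<lambda>x. x *\<^sub>R _"] cong: if_cong)

lemma smooth_heis_frame: "smooth (heis_frame lam k)"
  unfolding heis_frame_eq_frame_field by (rule smooth_frame_field[OF smooth_const])

lemma heis_metric_frame_comp:
  assumes "lam \<noteq> 0"
  shows "heis_metric lam p (Y p) (Z p) = frame_comp lam Y p $ 1 * frame_comp lam Z p $ 1
    + frame_comp lam Y p $ 2 * frame_comp lam Z p $ 2 - frame_comp lam Y p $ 3 * frame_comp lam Z p $ 3"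
  using assms by (simp add: heis_metric_def frame_comp_nth power2_eq_square)

section \<open>Connection, bracket and curvature in frame components\<close>

lemma gram_heis_metric:
  "gram (heis_metric lam) p =
    vector [vector [- 1 / lam\<^sup>2, 0, 0], vector [0, 1 + (p$1)\<^sup>2, p$1], vector [0, p$1, 1]]"
  by (simp add: vec_eq_iff forall_3 gram_def heis_metric_def axis_def power2_eq_square)

text \<open>\<open>matrix_inv\<close> picks some two-sided inverse. For square matrices a right
  inverse is two-sided, and inverses are unique, so the choice must be \<open>B\<close>.\<close>

lemma matrix_inv_eqI:
  fixes A :: "real ^ 'n ^ 'n"
  assumes "A ** B = mat 1"
  shows "matrix_inv A = B"
proof -
  have "B ** A = mat 1" using assms by (simp add: matrix_left_right_inverse)
  then have "matrix_inv A ** A = mat 1"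
    using assms unfolding matrix_inv_def by (metis (mono_tags, lifting) someI_ex)
  then show ?thesis using assms by (metis matrix_mul_assoc matrix_mul_lid matrix_mul_rid)
qed

lemma matrix_inv_gram_heis_metric:
  assumes "lam \<noteq> 0"
  shows "matrix_inv (gram (heis_metric lam) p) =
    vector [vector [- lam\<^sup>2, 0, 0], vector [0, 1, - p$1], vector [0, - p$1, 1 + (p$1)\<^sup>2]]"
  by (rule matrix_inv_eqI)
    (use assms in \<open>simp_all add: gram_heis_metric matrix_matrix_mult_def vec_eq_iff forall_3 sum_3
      mat_def power2_eq_square algebra_simps\<close>)

lemma dgram_heis_metric:
  "dgram (heis_metric lam) p l i j =
    (if l = 1 then (if i = 2 \<and> j = 2 then 2 * p$1 else if i = 2 \<and> j = 3 \<or> i = 3 \<and> j = 2 then 1 else 0)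
     else 0)"
proof -
  let ?x = "\<lambda>q :: real ^ 3. q $ 1"
  have "frechet_derivative ?x (at p) = (\<lambda>v. v $ 1)"
    "frechet_derivative (\<lambda>q. 1 + (?x q)\<^sup>2) (at p) = (\<lambda>v. 2 * p$1 * v$1)"
    using exhaust_3[of i]
    by (auto intro!: frechet_derivative_at[symmetric] derivative_eq_intros
        bounded_linear_imp_has_derivative bounded_linear_vec_nth)
  then show ?thesis
    using exhaust_3[of l] exhaust_3[of i] exhaust_3[of j]
    by (auto simp: dgram_def gram_heis_metric axis_def)
qed

text \<open>Passes from the coordinate Christoffel symbols, which depend on the point, to the
  left-invariant frame, where the connection coefficients are the constants 0,
  \<open>lam / 2\<close> and \<open>- lam / 2\<close>. Only the \<open>e1\<close> part is
  antisymmetric, matching the torsion-free condition for \<open>[e2, e3] = lam e1\<close>.\<close>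

lemma frame_comp_nabla:
  assumes lam: "lam \<noteq> 0" and Y: "smooth Y" and Z: "smooth Z"
  defines "a \<equiv> frame_comp lam Y" and "b \<equiv> frame_comp lam Z"
  shows "frame_comp lam (nabla (heis_metric lam) Y Z) p $ 1 =
      dderiv Y (\<lambda>q. b q $ 1) p + lam / 2 * (a p $ 2 * b p $ 3 - a p $ 3 * b p $ 2)"
    and "frame_comp lam (nabla (heis_metric lam) Y Z) p $ 2 =
      dderiv Y (\<lambda>q. b q $ 2) p + lam / 2 * (a p $ 1 * b p $ 3 + a p $ 3 * b p $ 1)"
    and "frame_comp lam (nabla (heis_metric lam) Y Z) p $ 3 =
      dderiv Y (\<lambda>q. b q $ 3) p + lam / 2 * (a p $ 1 * b p $ 2 + a p $ 2 * b p $ 1)"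
  unfolding a_def b_def
  using lam Y Z
  by (simp_all add: frame_comp_nth nabla_def dderiv_simps dderiv_vec_nth smooth_intros sum_3
      christoffel_def matrix_inv_gram_heis_metric dgram_heis_metric field_simps power2_eq_square)

lemma smooth_of_frame_comp:
  assumes lam: "lam \<noteq> 0" and s: "\<And>i. smooth (\<lambda>p. frame_comp lam Y p $ i)"
  shows "smooth Y"
proof -
  have "Y = (\<lambda>p. frame_field lam (frame_comp lam Y p) p)"
    using lam by (simp add: fun_eq_iff vec_eq_iff forall_3 frame_field_nth frame_comp_nth)
  then show ?thesis using smooth_frame_field[OF smooth_vecI[OF s]] by metis
qed

lemma smooth_nabla:
  assumes lam: "lam \<noteq> 0" and Y: "smooth Y" and Z: "smooth Z"
  shows "smooth (nabla (heis_metric lam) Y Z)"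
proof (rule smooth_of_frame_comp[OF lam])
  fix i :: 3
  show "smooth (\<lambda>p. frame_comp lam (nabla (heis_metric lam) Y Z) p $ i)"
    using exhaust_3[of i] Y Z
    by (elim disjE)
      (simp_all add: frame_comp_nabla[OF lam Y Z] smooth_intros smooth_dderiv smooth_frame_comp)
qed

lemma frame_comp_bracket:
  assumes lam: "lam \<noteq> 0" and Y: "smooth Y" and Z: "smooth Z"
  defines "a \<equiv> frame_comp lam Y" and "b \<equiv> frame_comp lam Z"
  shows "frame_comp lam (bracket Y Z) p $ i = dderiv Y (\<lambda>q. b q $ i) p - dderiv Z (\<lambda>q. a q $ i) p
    + (if i = 1 then lam * (a p $ 2 * b p $ 3 - a p $ 3 * b p $ 2) else 0)"
  unfolding a_def b_def
  using lam Y Z exhaust_3[of i]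
  by (auto simp: frame_comp_nth bracket_nth dderiv_simps smooth_intros field_simps)

text \<open>The curvature tensor in frame components. Planes spanned by \<open>e1\<close> and
  another frame vector contribute with weight \<open>lam\<^sup>2 / 4\<close>, the plane of
  \<open>e2\<close> and \<open>e3\<close> with weight three times as large.\<close>

definition heis_curv :: "real \<Rightarrow> real ^ 3 \<Rightarrow> real ^ 3 \<Rightarrow> real ^ 3 \<Rightarrow> real ^ 3" where
  "heis_curv lam a b c = vector
    [lam\<^sup>2 / 4 * ((a$1 * b$3 - a$3 * b$1) * c$3 - (a$1 * b$2 - a$2 * b$1) * c$2),
     lam\<^sup>2 / 4 * ((a$1 * b$2 - a$2 * b$1) * c$1 - 3 * (a$2 * b$3 - a$3 * b$2) * c$3),
     lam\<^sup>2 / 4 * ((a$1 * b$3 - a$3 * b$1) * c$1 - 3 * (a$2 * b$3 - a$3 * b$2) * c$2)]"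

definition heis_ric :: "real \<Rightarrow> real ^ 3 \<Rightarrow> real ^ 3 \<Rightarrow> real" where
  "heis_ric lam a b = lam\<^sup>2 / 2 * (a$2 * b$2 - a$1 * b$1 - a$3 * b$3)"

lemma frame_comp_diff: "frame_comp lam (\<lambda>p. Y p - Z p) p = frame_comp lam Y p - frame_comp lam Z p"
  by (simp add: vec_eq_iff forall_3 frame_comp_nth algebra_simps diff_divide_distrib)

text \<open>Second derivatives of the components of \<open>W\<close> cancel by
  \<open>dderiv_bracket\<close>, derivatives of those of \<open>Y\<close> and \<open>Z\<close>
  against the bracket term; the products of connection coefficients and the structure constant
  remain.\<close>

lemma frame_comp_curvature:
  assumes lam: "lam \<noteq> 0" and Y: "smooth Y" and Z: "smooth Z" and W: "smooth W"
  shows "frame_comp lam (curvature (heis_metric lam) Y Z W) p =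
    heis_curv lam (frame_comp lam Y p) (frame_comp lam Z p) (frame_comp lam W p)"
proof -
  note s = Y Z W smooth_bracket[OF Y Z] smooth_nabla[OF lam Y W] smooth_nabla[OF lam Z W]
  note sf = s[THEN smooth_frame_comp[of _ lam], THEN smooth_vec_nth]
  note sd = sf[THEN smooth_dderiv[OF Y]] sf[THEN smooth_dderiv[OF Z]]
  show ?thesis
    unfolding curvature_def
    by (simp add: frame_comp_diff vec_eq_iff forall_3 frame_comp_nabla lam s heis_curv_def
        frame_comp_bracket dderiv_simps dderiv_bracket smooth_intros sf sd)
      (simp add: field_simps power2_eq_square)
qed


lemma heis_frame_comp:
  assumes "lam \<noteq> 0"
  shows "frame_comp lam (heis_frame lam k) p = axis k 1"
  using assms exhaust_3[of k]
  by (auto simp: vec_eq_iff forall_3 frame_comp_nth heis_frame_nth axis_def)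

lemma frame_comp_frame_field:
  assumes "lam \<noteq> 0"
  shows "frame_comp lam (frame_field lam a) p = a"
  using assms by (simp add: vec_eq_iff forall_3 frame_comp_nth frame_field_nth)

lemma frame_comp_eq_0_iff:
  assumes "lam \<noteq> 0"
  shows "frame_comp lam Y p = 0 \<longleftrightarrow> Y p = 0"
  using assms by (auto simp: vec_eq_iff forall_3 frame_comp_nth)

text \<open>The sign \<open>g(e_k, e_k)\<close> makes each summand the \<open>k\<close>-th frame
  component of the curvature, so the sum is a plain trace also in Lorentzian signature.\<close>

lemma ricci_heis:
  assumes lam: "lam \<noteq> 0" and Y: "smooth Y" and Z: "smooth Z"
  shows "ricci (heis_metric lam) (heis_frame lam) Y Z p =
    heis_ric lam (frame_comp lam Y p) (frame_comp lam Z p)"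
  unfolding ricci_def
  by (simp only: heis_metric_frame_comp[OF lam] frame_comp_curvature[OF lam smooth_heis_frame Y Z]
      heis_frame_comp[OF lam])
    (simp add: sum_3 axis_def heis_curv_def heis_ric_def algebra_simps)

lemma smooth_curvature:
  assumes "lam \<noteq> 0" "smooth Y" "smooth Z" "smooth W"
  shows "smooth (curvature (heis_metric lam) Y Z W)"
  unfolding curvature_def
  by (intro smooth_diff smooth_nabla smooth_bracket assms)

section \<open>Lie derivatives in the frame as the action of a matrix\<close>

lemma dderiv_frame:
  assumes "lam \<noteq> 0" "smooth f"
  shows "dderiv Y f p = (\<Sum>j\<in>UNIV. frame_comp lam Y p $ j *\<^sub>R dderiv (heis_frame lam j) f p)"
  by (rule dderiv_sum[OF assms(2)])
    (use assms(1) in \<open>simp add: sum_3 vec_eq_iff forall_3 frame_comp_nth heis_frame_nth\<close>)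

text \<open>
  The matrix of \<open>Y \<mapsto> - [X, Y]\<close> on fields with constant frame components; the last summand is the
  contribution of \<open>[e\<^sub>2, e\<^sub>3] = lam e\<^sub>1\<close>.
\<close>

definition lie_matrix :: "real \<Rightarrow> 3 vfield \<Rightarrow> real ^ 3 \<Rightarrow> real ^ 3 ^ 3" where
  "lie_matrix lam X p = (\<chi> i j. dderiv (heis_frame lam j) (\<lambda>q. frame_comp lam X q $ i) p
     + (if i = 1 \<and> j = 2 then lam * frame_comp lam X p $ 3
        else if i = 1 \<and> j = 3 then - lam * frame_comp lam X p $ 2 else 0))"

lemma frame_comp_bracket_lie_matrix:
  assumes lam: "lam \<noteq> 0" and X: "smooth X" and Y: "smooth Y"
  shows "frame_comp lam (bracket X Y) p $ i = dderiv X (\<lambda>q. frame_comp lam Y q $ i) p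
    - (lie_matrix lam X p *v frame_comp lam Y p) $ i"
  using exhaust_3[of i]
  by (auto simp: frame_comp_bracket[OF lam X Y] lie_matrix_def matrix_vector_mult_def sum_3
      dderiv_frame[OF lam smooth_vec_nth[OF smooth_frame_comp[OF X]], of Y] algebra_simps)

text \<open>The metric has constant frame coefficients, so by the product rule all derivatives along
  \<open>X\<close> cancel and only the matrix part of the brackets survives. The Ricci tensor and
  the curvature are treated in the same way.\<close>

lemma lie02_metric_heis:
  assumes lam: "lam \<noteq> 0" and X: "smooth X" and Y: "smooth Y" and Z: "smooth Z"
  defines "G \<equiv> (\<lambda>a b :: real ^ 3. a$1 * b$1 + a$2 * b$2 - a$3 * b$3)"
  shows "lie02 X (\<lambda>U V q. heis_metric lam q (U q) (V q)) Y Z p =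
    G (lie_matrix lam X p *v frame_comp lam Y p) (frame_comp lam Z p) +
    G (frame_comp lam Y p) (lie_matrix lam X p *v frame_comp lam Z p)"
  unfolding lie02_def heis_metric_frame_comp[OF lam] G_def
  by (simp add: frame_comp_bracket_lie_matrix lam X Y Z dderiv_simps smooth_intros smooth_frame_comp)
    (simp add: algebra_simps)

lemma lie02_ricci_heis:
  assumes lam: "lam \<noteq> 0" and X: "smooth X" and Y: "smooth Y" and Z: "smooth Z"
  shows "lie02 X (ricci (heis_metric lam) (heis_frame lam)) Y Z p =
    heis_ric lam (lie_matrix lam X p *v frame_comp lam Y p) (frame_comp lam Z p) +
    heis_ric lam (frame_comp lam Y p) (lie_matrix lam X p *v frame_comp lam Z p)"
proof -
  have "ricci (heis_metric lam) (heis_frame lam) Y Z =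
      (\<lambda>p. heis_ric lam (frame_comp lam Y p) (frame_comp lam Z p))"
    using ricci_heis[OF lam Y Z] by auto
  then show ?thesis
    unfolding lie02_def
    by (simp add: ricci_heis lam X Y Z smooth_bracket heis_ric_def frame_comp_bracket_lie_matrix
        dderiv_simps smooth_intros smooth_frame_comp)
      (simp add: field_simps)
qed

text \<open>The action of \<open>M\<close> as a derivation on a (1,3)-tensor: the vector-valued
  output slot enters with the opposite sign to the three arguments.\<close>

definition curv_action :: "real \<Rightarrow> real ^ 3 ^ 3 \<Rightarrow> real ^ 3 \<Rightarrow> real ^ 3 \<Rightarrow> real ^ 3 \<Rightarrow> real ^ 3" where
  "curv_action lam M a b c = heis_curv lam (M *v a) b c + heis_curv lam a (M *v b) c
     + heis_curv lam a b (M *v c) - M *v heis_curv lam a b c"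

lemma frame_comp_lie13_curvature:
  assumes lam: "lam \<noteq> 0" and X: "smooth X" and Y: "smooth Y" and Z: "smooth Z" and W: "smooth W"
  shows "frame_comp lam (lie13 X (curvature (heis_metric lam)) Y Z W) p =
    curv_action lam (lie_matrix lam X p) (frame_comp lam Y p) (frame_comp lam Z p) (frame_comp lam W p)"
proof -
  note s = X Y Z W smooth_curvature[OF lam Y Z W]
  note sf = s[THEN smooth_frame_comp[of _ lam], THEN smooth_vec_nth]
  show ?thesis
    unfolding lie13_def curv_action_def
    by (simp add: frame_comp_diff vec_eq_iff forall_3 frame_comp_bracket_lie_matrix lam s
        smooth_bracket frame_comp_curvature)
      (simp add: heis_curv_def dderiv_simps smooth_intros sf frame_comp_bracket_lie_matrix lam s;
        simp add: field_simps power2_eq_square)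
qed

text \<open>The conditions say that \<open>M p\<close> is skew for \<open>diag(1, 1, -1)\<close>,
  that is, an infinitesimal Lorentz transformation of the frame.\<close>

lemma killing_heisI:
  assumes lam: "lam \<noteq> 0" and X: "smooth X"
  defines "M \<equiv> lie_matrix lam X"
  assumes "\<And>p. M p$1$1 = 0 \<and> M p$2$2 = 0 \<and> M p$3$3 = 0 \<and>
      M p$2$1 = - M p$1$2 \<and> M p$3$1 = M p$1$3 \<and> M p$3$2 = M p$2$3"
  shows "killing (heis_metric lam) X"
  using assms unfolding killing_def
  by (auto simp: lie02_metric_heis matrix_vector_mult_def sum_3 algebra_simps)

section \<open>Collineations as pointwise algebraic conditions on the matrix\<close>

lemma ricci_collineation_heis_iff:
  assumes lam: "lam \<noteq> 0" and X: "smooth X"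
  defines "M \<equiv> lie_matrix lam X"
  shows "ricci_collineation (heis_metric lam) (heis_frame lam) X \<longleftrightarrow>
    (\<forall>p a b. heis_ric lam (M p *v a) b + heis_ric lam a (M p *v b) = 0)"
    (is "?L \<longleftrightarrow> ?R")
proof
  assume ?R
  then show ?L
    using X by (simp add: ricci_collineation_def lie02_ricci_heis lam M_def)
next
  assume L: ?L
  have s: "smooth (frame_field lam a)" for a by (rule smooth_frame_field[OF smooth_const])
  show ?R
  proof (intro allI)
    fix p a b
    \<comment> \<open>Testing on left-invariant fields realizes arbitrary component vectors
      \<open>a\<close> and \<open>b\<close> at \<open>p\<close>.\<close>
    have "lie02 X (ricci (heis_metric lam) (heis_frame lam)) (frame_field lam a) (frame_field lam b) p = 0"
      using L s by (simp add: ricci_collineation_def)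
    then show "heis_ric lam (M p *v a) b + heis_ric lam a (M p *v b) = 0"
      by (simp add: lie02_ricci_heis[OF lam X s s] frame_comp_frame_field[OF lam] M_def)
  qed
qed

lemma curvature_collineation_heis_iff:
  assumes lam: "lam \<noteq> 0" and X: "smooth X"
  shows "curvature_collineation (heis_metric lam) X \<longleftrightarrow>
    (\<forall>p a b c. curv_action lam (lie_matrix lam X p) a b c = 0)"
    (is "?L \<longleftrightarrow> ?R")
proof
  assume ?R
  then show ?L
    using X unfolding curvature_collineation_def
    by (metis frame_comp_eq_0_iff frame_comp_lie13_curvature lam)
next
  assume L: ?L
  have s: "smooth (frame_field lam a)" for a by (rule smooth_frame_field[OF smooth_const])
  show ?R
  proof (intro allI)
    fix p a b c
    have "lie13 X (curvature (heis_metric lam)) (frame_field lam a) (frame_field lam b) (frame_field lam c) p = 0"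
      using L s by (auto simp: curvature_collineation_def)
    then show "curv_action lam (lie_matrix lam X p) a b c = 0"
      using frame_comp_lie13_curvature[OF lam X s s s] frame_comp_frame_field[OF lam] frame_comp_eq_0_iff[OF lam]
      by metis
  qed
qed

text \<open>Contraction commutes with the derivation: the terms where \<open>M\<close> hits the
  contracted argument and the output are traces of the same two maps composed in opposite orders, so
  they cancel.\<close>

lemma trace_curv_action:
  "(\<Sum>k\<in>UNIV. curv_action lam M (axis k 1) a b $ k) = heis_ric lam (M *v a) b + heis_ric lam a (M *v b)"
  by (simp add: curv_action_def heis_curv_def heis_ric_def matrix_vector_mult_def sum_3 axis_def)
    (simp add: field_simps)

lemma heis_ric_invariantD:
  assumes lam: "lam \<noteq> 0" and M: "\<And>a b. heis_ric lam (M *v a) b + heis_ric lam a (M *v b) = 0"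
  shows "M$1$1 = 0 \<and> M$2$2 = 0 \<and> M$3$3 = 0 \<and> M$2$1 = M$1$2 \<and> M$3$1 = - M$1$3 \<and> M$3$2 = M$2$3"
proof -
  \<comment> \<open>The Ricci form without its nonzero factor \<open>lam\<^sup>2 / 2\<close>; on
    pairs of basis vectors, invariance becomes skewness of \<open>M\<close> for
    \<open>diag(-1, 1, -1)\<close>.\<close>
  define Q where "Q a b = a$2 * b$2 - a$1 * b$1 - a$3 * b$3" for a b :: "real ^ 3"
  have *: "Q (M *v axis i 1) (axis j 1) + Q (axis i 1) (M *v axis j 1) = 0" for i j
  proof -
    have "lam\<^sup>2 / 2 * (Q (M *v axis i 1) (axis j 1) + Q (axis i 1) (M *v axis j 1)) = 0"
      using M[of "axis i 1" "axis j 1"] by (simp only: heis_ric_def Q_def distrib_left)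
    with lam show ?thesis by simp
  qed
  show ?thesis
    using *[of 1 1] *[of 2 2] *[of 3 3] *[of 1 2] *[of 1 3] *[of 2 3]
    by (simp add: Q_def matrix_vector_mult_def sum_3 axis_def)
qed

text \<open>Such an \<open>M\<close> is skew for the metric and, being traceless on the plane of
  \<open>e2\<close> and \<open>e3\<close> and zero on \<open>e1\<close>, a derivation of the Lie
  algebra. It therefore preserves everything built from metric and bracket.\<close>

lemma curv_action_boost:
  assumes "M$1$1 = 0" "M$2$2 = 0" "M$3$3 = 0" "M$1$2 = 0" "M$1$3 = 0" "M$2$1 = 0" "M$3$1 = 0"
    "M$3$2 = M$2$3"
  shows "curv_action lam M a b c = 0"
  using assms
  by (simp add: curv_action_def heis_curv_def matrix_vector_mult_def sum_3 vec_eq_iff forall_3)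
    (simp add: field_simps)

section \<open>Integrability of the Ricci equations and the equivalence of collineations\<close>

lemma dderiv_heis_frame_commute:
  assumes lam: "lam \<noteq> 0" and f: "smooth f"
  defines "E \<equiv> (\<lambda>j. dderiv (heis_frame lam j))"
  shows "E 2 (E 1 f) = E 1 (E 2 (f :: _ \<Rightarrow> real))"
    and "E 3 (E 1 f) = E 1 (E 3 f)"
    and "E 2 (E 3 f) p - E 3 (E 2 f) p = lam * E 1 f p"
proof -
  have *: "E i (E j f) p - E j (E i f) p =
      (\<Sum>k\<in>UNIV. frame_comp lam (bracket (heis_frame lam i) (heis_frame lam j)) p $ k * E k f p)" for i j p
    unfolding E_def
    by (subst dderiv_bracket[OF smooth_heis_frame smooth_heis_frame f, symmetric])
      (subst dderiv_frame[OF lam f], simp)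
  note b = frame_comp_bracket[OF lam smooth_heis_frame smooth_heis_frame]
  show "E 2 (E 1 f) = E 1 (E 2 f)"
    using *[of 2 1] by (simp add: fun_eq_iff sum_3 b heis_frame_comp lam dderiv_const axis_def)
  show "E 3 (E 1 f) = E 1 (E 3 f)"
    using *[of 3 1] by (simp add: fun_eq_iff sum_3 b heis_frame_comp lam dderiv_const axis_def)
  show "E 2 (E 3 f) p - E 3 (E 2 f) p = lam * E 1 f p"
    using *[of 2 3] by (simp add: sum_3 b heis_frame_comp lam dderiv_const axis_def)
qed

text \<open>
  Writing \<open>u' = e\<^sub>1 u\<close>: the equations for \<open>f\<^sub>1\<close> give \<open>f\<^sub>2'' = lam f\<^sub>3'\<close> and \<open>f\<^sub>3'' = lam f\<^sub>2'\<close>, while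
  \<open>[e\<^sub>2, e\<^sub>3] f\<^sub>1 = 0\<close> kills all derivatives of \<open>f\<^sub>2'\<close> and \<open>f\<^sub>3'\<close> along \<open>e\<^sub>2\<close> and \<open>e\<^sub>3\<close>, hence, by the
  same bracket, along \<open>e\<^sub>1\<close>.
\<close>

lemma ricci_killing_equations:
  fixes f1 f2 f3 :: "real ^ 3 \<Rightarrow> real"
  assumes lam: "lam \<noteq> 0" and f: "smooth f1" "smooth f2" "smooth f3"
  defines "E \<equiv> (\<lambda>j. dderiv (heis_frame lam j))"
  assumes eq: "\<And>p. E 1 f1 p = 0" "\<And>p. E 2 f2 p = 0" "\<And>p. E 3 f3 p = 0"
    "\<And>p. E 2 f1 p + lam * f3 p = E 1 f2 p" "\<And>p. E 3 f1 p - lam * f2 p = - E 1 f3 p"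
    "\<And>p. E 2 f3 p = E 3 f2 p"
  shows "E 1 f2 p = 0 \<and> E 1 f3 p = 0"
proof -
  have zero: "E j (\<lambda>p. 0) = (\<lambda>p. 0)" for j by (simp add: E_def dderiv_const)
  have cmult: "E j (\<lambda>p. lam * g p) p = lam * E j g p" if "smooth g" for j g p
    using that by (simp add: E_def dderiv_mult dderiv_const smooth_const)
  have Ediff: "E j (\<lambda>p. g p - h p) p = E j g p - E j h p" if "smooth g" "smooth h" for j g h p
    using that by (simp add: E_def dderiv_diff)
  have sE: "smooth (E j g)" if "smooth g" for j g
    using that unfolding E_def by (intro smooth_dderiv smooth_heis_frame)
  have com: "E 2 (E 1 g) = E 1 (E 2 g)" "E 3 (E 1 g) = E 1 (E 3 g)"
    "E 2 (E 3 g) p - E 3 (E 2 g) p = lam * E 1 g p" if "smooth g" for g p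
    using dderiv_heis_frame_commute[OF lam that] by (simp_all add: E_def)
  have E1f1: "E 1 f1 = (\<lambda>p. 0)" and E2f2: "E 2 f2 = (\<lambda>p. 0)" and E3f3: "E 3 f3 = (\<lambda>p. 0)"
    and E2f1: "E 2 f1 = (\<lambda>p. E 1 f2 p - lam * f3 p)"
    and E2f3: "E 2 f3 = E 3 f2"
    by (rule ext, use eq in \<open>simp add: eq_diff_eq\<close>)+
  have E3f1: "E 3 f1 = (\<lambda>p. lam * f2 p - E 1 f3 p)"
  proof
    show "E 3 f1 p = lam * f2 p - E 1 f3 p" for p using eq(5)[of p] by linarith
  qed
  note s = f f[THEN sE] f[THEN sE, THEN sE] smooth_mult[OF smooth_const]
  have 1: "E 1 (E 1 f2) p = lam * E 1 f3 p" for p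
    using fun_cong[OF com(1)[OF f(1)], of p] by (simp add: E1f1 E2f1 zero Ediff cmult s)
  have 2: "E 1 (E 1 f3) p = lam * E 1 f2 p" for p
    using fun_cong[OF com(2)[OF f(1)], of p] by (simp add: E1f1 E3f1 zero Ediff cmult s)
  \<comment> \<open>\<open>E 2 (E 3 f1)\<close> equals \<open>- E 1 (E 3 f2)\<close> and
    \<open>E 3 (E 2 f1)\<close> equals \<open>E 1 (E 3 f2)\<close>, while their difference is
    \<open>lam * E 1 f1 p = 0\<close>.\<close>
  have 3: "E 1 (E 3 f2) p = 0" for p
    using com(3)[OF f(1), of p] com(1)[OF f(3)] com(2)[OF f(2)]
    by (simp add: E1f1 E2f1 E3f1 E2f2 E3f3 E2f3 Ediff cmult s)
  have u: "E 2 (E 1 f2) = (\<lambda>p. 0)" "E 3 (E 1 f2) = (\<lambda>p. 0)"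
    and v: "E 2 (E 1 f3) = (\<lambda>p. 0)" "E 3 (E 1 f3) = (\<lambda>p. 0)"
    using com(1,2)[OF f(2)] com(1,2)[OF f(3)] 3 by (auto simp: E2f2 E3f3 E2f3 zero)
  have "lam * E 1 (E 1 f2) p = 0" "lam * E 1 (E 1 f3) p = 0"
    using com(3)[OF sE[OF f(2)], of 1 p] com(3)[OF sE[OF f(3)], of 1 p] by (simp_all add: u v zero)
  \<comment> \<open>By \<open>1\<close> and \<open>2\<close> the vanishing second derivatives are
    \<open>lam\<close> times the wanted first derivatives, with \<open>f2\<close> and
    \<open>f3\<close> exchanged.\<close>
  with 1 2 lam show ?thesis by simp
qed

lemma lie_matrix_heis_ric_invariant:
  assumes lam: "lam \<noteq> 0" and X: "smooth X"
    and inv: "\<And>p a b. heis_ric lam (lie_matrix lam X p *v a) b + heis_ric lam a (lie_matrix lam X p *v b) = 0"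
  shows "lie_matrix lam X p $ 1 $ 2 = 0" "lie_matrix lam X p $ 1 $ 3 = 0"
proof -
  note M = heis_ric_invariantD[OF lam inv]
  have "dderiv (heis_frame lam 1) (\<lambda>q. frame_comp lam X q $ 2) p = 0 \<and>
      dderiv (heis_frame lam 1) (\<lambda>q. frame_comp lam X q $ 3) p = 0"
    by (rule ricci_killing_equations[where ?f1.0 = "\<lambda>q. frame_comp lam X q $ 1", OF lam])
      (use M in \<open>simp_all add: lie_matrix_def smooth_vec_nth smooth_frame_comp X algebra_simps\<close>)
  \<comment> \<open>The two derivatives are the entries (2,1) and (3,1); the invariance relations
    carry their vanishing over to (1,2) and (1,3).\<close>
  then show "lie_matrix lam X p $ 1 $ 2 = 0" "lie_matrix lam X p $ 1 $ 3 = 0"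
    using M[of p] by (simp_all add: lie_matrix_def)
qed

lemma ricci_collineation_iff_curvature_collineation_heis:
  assumes lam: "lam \<noteq> 0" and X: "smooth X"
  shows "ricci_collineation (heis_metric lam) (heis_frame lam) X \<longleftrightarrow>
    curvature_collineation (heis_metric lam) X"
  unfolding ricci_collineation_heis_iff[OF lam X] curvature_collineation_heis_iff[OF lam X]
proof
  assume *: "\<forall>p a b. heis_ric lam (lie_matrix lam X p *v a) b + heis_ric lam a (lie_matrix lam X p *v b) = 0"
  then have "lie_matrix lam X p $ 1 $ 2 = 0" "lie_matrix lam X p $ 1 $ 3 = 0" for p
    using lie_matrix_heis_ric_invariant[OF lam X] by blast+
  then show "\<forall>p a b c. curv_action lam (lie_matrix lam X p) a b c = 0"
    using heis_ric_invariantD[OF lam *[rule_format]]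
    by (intro allI curv_action_boost) simp_all
next
  assume "\<forall>p a b c. curv_action lam (lie_matrix lam X p) a b c = 0"
  then show "\<forall>p a b. heis_ric lam (lie_matrix lam X p *v a) b + heis_ric lam a (lie_matrix lam X p *v b) = 0"
    by (simp add: trace_curv_action[symmetric])
qed

theorem mainTheorem13:
  fixes lam :: real
  assumes "lam \<noteq> 0"
  shows "(\<forall>(c1::real) (c2::real) (c3::real) (c4::real) f1 f2 f3.
            f1 = (\<lambda>p. c1 / (2 * lam) * (p$1)\<^sup>2 - lam * c1 / 2 * (p$2)\<^sup>2 + c2 * p$1 - lam * c3 * p$2 + c4) \<longrightarrow>
            f2 = (\<lambda>p. c1 / lam * p$1 + c2) \<longrightarrow>
            f3 = (\<lambda>p. c1 * p$2 + c3) \<longrightarrow>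
            killing (heis_metric lam)
              (\<lambda>p. f1 p *\<^sub>R heis_frame lam 1 p + f2 p *\<^sub>R heis_frame lam 2 p + f3 p *\<^sub>R heis_frame lam 3 p))
       \<and> (\<forall>X :: 3 vfield. smooth X \<longrightarrow>
            (ricci_collineation (heis_metric lam) (heis_frame lam) X
               \<longleftrightarrow> curvature_collineation (heis_metric lam) X))"
proof (intro conjI allI impI)
  fix c1 c2 c3 c4 :: real and f1 f2 f3 :: "real ^ 3 \<Rightarrow> real"
  assume f: "f1 = (\<lambda>p. c1 / (2 * lam) * (p$1)\<^sup>2 - lam * c1 / 2 * (p$2)\<^sup>2 + c2 * p$1 - lam * c3 * p$2 + c4)"
    "f2 = (\<lambda>p. c1 / lam * p$1 + c2)" "f3 = (\<lambda>p. c1 * p$2 + c3)"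
  define X where "X p = f1 p *\<^sub>R heis_frame lam 1 p + f2 p *\<^sub>R heis_frame lam 2 p + f3 p *\<^sub>R heis_frame lam 3 p" for p
  have comp: "frame_comp lam X p $ 1 = f1 p" "frame_comp lam X p $ 2 = f2 p" "frame_comp lam X p $ 3 = f3 p" for p
    using assms by (simp_all add: frame_comp_nth X_def heis_frame_nth)
  have sf: "smooth f1" "smooth f2" "smooth f3"
    unfolding f by (intro smooth_intros)+
  have "smooth X"
  proof (rule smooth_of_frame_comp[OF assms])
    show "smooth (\<lambda>p. frame_comp lam X p $ i)" for i
      using exhaust_3[of i] sf by (elim disjE) (simp_all add: comp)
  qed
  \<comment> \<open>The derivatives of \<open>f1\<close> along \<open>e2\<close> and
    \<open>e3\<close> are \<open>- lam * f3\<close> and \<open>lam * f2\<close>, cancelling the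
    bracket terms. The matrix is thus constant, with \<open>c1\<close> at (2,3) and (3,2) and zeros
    elsewhere: a boost.\<close>
  then have "killing (heis_metric lam) X"
    by (rule killing_heisI[OF assms])
      (use assms in \<open>simp add: lie_matrix_def comp, simp add: f dderiv_simps smooth_intros heis_frame_nth
        field_simps power2_eq_square\<close>)
  then show "killing (heis_metric lam)
      (\<lambda>p. f1 p *\<^sub>R heis_frame lam 1 p + f2 p *\<^sub>R heis_frame lam 2 p + f3 p *\<^sub>R heis_frame lam 3 p)"
    by (simp add: X_def[abs_def])
next
  show "ricci_collineation (heis_metric lam) (heis_frame lam) X \<longleftrightarrow>
      curvature_collineation (heis_metric lam) X" if "smooth X" for X
    by (rule ricci_collineation_iff_curvature_collineation_heis[OF assms that])
qed

end
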